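(* There exists an absolute constant $C>0$ such that the following holds. For positive integers $n$ and $k$ with $k\mid n$, let $\mathrm{Comb}_{n,k}$ denote the $n$-vertex tree consisting of a path $P$ on $n/k$ vertices together with $n/k$ pairwise vertex-disjoint paths on $k$ vertices each, one beginning at each vertex of $P$ (each such $k$-vertex path has one endpoint equal to a vertex of $P$ and is otherwise disjoint from $P$). Then for every choice of $k=k(n)$ with $k\mid n$, the random graph $\mathcal{G}(n,C\frac{\log n}{n})$ contains a copy of $\mathrm{Comb}_{n,k}$ with probability tending to $1$ as $n\to\infty$.
   Context: $\mathcal{G}(n,p)$ denotes the binomial random graph on vertex set $[n]=\{1,\dots,n\}$ in which each of the $\binom n2$ possible edges is present independently with probability $p$. $\log$ denotes the natural logarithm. *)

theory Defs
  imports "HOL-Probability.Probability"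
begin

(* Binomial random graph G(n,p) on vertex set {1..n}: a graph is encoded by the
   indicator of its edge set on pairs (i,j) with 1 <= i < j <= n; each such pair
   is an edge independently with probability p. *)
definition gnp :: "nat \<Rightarrow> real \<Rightarrow> (nat \<times> nat \<Rightarrow> bool) pmf" where
  "gnp n p = Pi_pmf {(i, j). 1 \<le> i \<and> i < j \<and> j \<le> n} False (\<lambda>_. bernoulli_pmf p)"

definition adj :: "(nat \<times> nat \<Rightarrow> bool) \<Rightarrow> nat \<Rightarrow> nat \<Rightarrow> bool" where
  "adj G u v \<longleftrightarrow> u \<noteq> v \<and> G (min u v, max u v)"

(* Comb_{n,k}: vertices (i,j), i < n/k, j < k. The spine P is {(i,0)}, with
   edges (i,0)-(i+1,0); the tooth at (i,0) is the k-vertex path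
   (i,0)-(i,1)-...-(i,k-1). *)
definition comb_verts :: "nat \<Rightarrow> nat \<Rightarrow> (nat \<times> nat) set" where
  "comb_verts n k = {0..<n div k} \<times> {0..<k}"

definition comb_edge :: "nat \<Rightarrow> nat \<Rightarrow> nat \<times> nat \<Rightarrow> nat \<times> nat \<Rightarrow> bool" where
  "comb_edge n k a b \<longleftrightarrow> a \<in> comb_verts n k \<and> b \<in> comb_verts n k \<and>
     ((snd a = 0 \<and> snd b = 0 \<and> fst b = fst a + 1) \<or> (fst b = fst a \<and> snd b = snd a + 1))"

definition contains_comb :: "nat \<Rightarrow> nat \<Rightarrow> (nat \<times> nat \<Rightarrow> bool) \<Rightarrow> bool" where
  "contains_comb n k G \<longleftrightarrow> (\<exists>f. inj_on f (comb_verts n k) \<and> f ` comb_verts n k \<subseteq> {1..n} \<and>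
      (\<forall>a b. comb_edge n k a b \<longrightarrow> adj G (f a) (f b)))"

end

theory Submission
  imports Defs
begin

text \<open>
  The uniform measure on the copies of the comb (indeed of any forest of maximum degree \<open>d\<close>) is
  \<open>O(1/n)\<close>-spread: a set of \<open>j\<close> edges spanning \<open>u \<le> 2j\<close> vertices lies in at most
  \<open>d\<^sup>j n\<^bsup>u - j\<^esup> (n - u)! \<le> n! (e\<^sup>2 d / n)\<^sup>j\<close> of the \<open>n!\<close> labelled copies. Whp containment at
  density \<open>O(log n / n)\<close> then follows from the theorem of Frankston, Kahn, Narayanan and Park on
  spread families, with the minimum fragments of Park and Pham: expose
  \<open>O(log n)\<close> random sets of density \<open>O(1/n)\<close>. In each round, replace every surviving copy \<open>S\<close> by a
  smallest remainder \<open>S' - W\<close> of a copy \<open>S' \<subseteq> S \<union> W\<close>. All but a tiny fraction of these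
  remainders have at most half the previous size bound, and passing to subsets does not hurt the
  spread. Once the remainders have bounded size, a single set of density \<open>O(log n / n)\<close> contains
  one of them.
\<close>

section \<open>Random subsets of a finite set\<close>

text \<open>Expectation of \<open>g\<close> over the \<open>p\<close>-random subset of \<open>X\<close>, as a finite sum instead of an integral.\<close>

definition rexp :: "real \<Rightarrow> 'a set \<Rightarrow> ('a set \<Rightarrow> real) \<Rightarrow> real" where
  "rexp p X g = (\<Sum>W\<in>Pow X. p ^ card W * (1 - p) ^ card (X - W) * g W)"

lemma rexp_empty [simp]: "rexp p {} g = g {}"
  by (simp add: rexp_def)

text \<open>Conditioning on whether \<open>x\<close> is chosen gives the recursion behind the
  inductions on \<open>X\<close> below.\<close>

lemma rexp_insert:
  assumes "finite X" "x \<notin> X"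
  shows "rexp p (insert x X) g = p * rexp p X (\<lambda>W. g (insert x W)) + (1 - p) * rexp p X g"
proof -
  have "rexp p (insert x X) g =
      (\<Sum>W\<in>Pow X. p ^ card W * (1 - p) ^ card (insert x X - W) * g W) +
      (\<Sum>W\<in>insert x ` Pow X. p ^ card W * (1 - p) ^ card (insert x X - W) * g W)"
    unfolding rexp_def Pow_insert using assms by (subst sum.union_disjoint) auto
  also have "(\<Sum>W\<in>insert x ` Pow X. p ^ card W * (1 - p) ^ card (insert x X - W) * g W) =
      (\<Sum>W\<in>Pow X. p ^ card (insert x W) * (1 - p) ^ card (insert x X - insert x W) * g (insert x W))"
    using assms by (intro sum.reindex_cong[of "insert x"]) (auto simp: inj_on_def)
  also have "\<dots> = p * rexp p X (\<lambda>W. g (insert x W))"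
    unfolding rexp_def sum_distrib_left
  proof (rule sum.cong)
    fix W assume "W \<in> Pow X"
    then have "card (insert x W) = Suc (card W)" "insert x X - insert x W = X - W"
      using assms finite_subset[of W X] by (auto simp: card_insert_if)
    then show "p ^ card (insert x W) * (1 - p) ^ card (insert x X - insert x W) * g (insert x W) =
        p * (p ^ card W * (1 - p) ^ card (X - W) * g (insert x W))" by simp
  qed simp
  also have "(\<Sum>W\<in>Pow X. p ^ card W * (1 - p) ^ card (insert x X - W) * g W) = (1 - p) * rexp p X g"
    unfolding rexp_def sum_distrib_left
  proof (rule sum.cong)
    fix W assume "W \<in> Pow X"
    then have "insert x X - W = insert x (X - W)" using assms by auto
    then have "card (insert x X - W) = Suc (card (X - W))" using assms by simp
    then show "p ^ card W * (1 - p) ^ card (insert x X - W) * g W =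
        (1 - p) * (p ^ card W * (1 - p) ^ card (X - W) * g W)" by simp
  qed simp
  finally show ?thesis by simp
qed

lemma rexp_add: "rexp p X (\<lambda>W. f W + g W) = rexp p X f + rexp p X g"
  by (simp add: rexp_def sum.distrib algebra_simps)

lemma rexp_cmult: "rexp p X (\<lambda>W. c * f W) = c * rexp p X f"
  by (simp add: rexp_def sum_distrib_left algebra_simps)

lemma rexp_const: "finite X \<Longrightarrow> rexp p X (\<lambda>_. c) = c"
  by (induction X rule: finite_induct) (simp_all add: rexp_insert algebra_simps)

lemma rexp_mono:
  assumes "0 \<le> p" "p \<le> 1" "\<And>W. W \<subseteq> X \<Longrightarrow> f W \<le> g W"
  shows "rexp p X f \<le> rexp p X g"
  unfolding rexp_def using assms by (intro sum_mono mult_left_mono) auto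

text \<open>The union of independent \<open>p\<close>- and \<open>q\<close>-random sets misses each
  element independently with probability \<open>(1 - p) * (1 - q)\<close>. This merges successive
  rounds of exposure into one random set.\<close>

lemma rexp_union:
  assumes "finite X"
  shows "rexp p X (\<lambda>U. rexp q X (\<lambda>W. g (U \<union> W))) = rexp (1 - (1 - p) * (1 - q)) X g"
  using assms
proof (induction X arbitrary: g rule: finite_induct)
  case (insert x X)
  have IH: "rexp p X (\<lambda>U. rexp q X (\<lambda>W. h (U \<union> W))) = rexp (1 - (1 - p) * (1 - q)) X h" for h
    by (rule insert.IH)
  show ?case
    using insert.hyps
    by (simp add: rexp_insert rexp_add rexp_cmult IH[of g] IH[of "\<lambda>W. g (insert x W)"]) (simp add: algebra_simps)
qed simp

text \<open>Coupling: a \<open>p\<close>-random set becomes \<open>p'\<close>-random by adding an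
  independent sprinkling, which can only raise a monotone \<open>g\<close>.\<close>

lemma rexp_mono_density:
  assumes "finite X" "0 \<le> p" "p \<le> p'" "p' \<le> 1" "p < 1"
    and "\<And>U W. U \<subseteq> W \<Longrightarrow> W \<subseteq> X \<Longrightarrow> g U \<le> g W"
  shows "rexp p X g \<le> rexp p' X g"
proof -
  \<comment> \<open>The sprinkling density solves \<open>(1 - p) * (1 - q) = 1 - p'\<close>.\<close>
  define q where "q = 1 - (1 - p') / (1 - p)"
  have q: "0 \<le> q" "q \<le> 1" using assms by (auto simp: q_def field_simps)
  have "rexp p X g = rexp p X (\<lambda>U. rexp q X (\<lambda>W. g U))"
    using assms by (simp add: rexp_const)
  also have "\<dots> \<le> rexp p X (\<lambda>U. rexp q X (\<lambda>W. g (U \<union> W)))"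
    using assms q by (intro rexp_mono) auto
  also have "\<dots> = rexp (1 - (1 - p) * (1 - q)) X g"
    by (rule rexp_union) fact
  also have "1 - (1 - p) * (1 - q) = p'" using assms by (simp add: q_def field_simps)
  finally show ?thesis .
qed

text \<open>Bridge to the product measure: with default \<open>False\<close>, its support consists
  of indicators of subsets of \<open>X\<close>, so the integral is a finite sum.\<close>

lemma prob_Pi_bernoulli:
  assumes "finite X" "0 \<le> p" "p \<le> 1"
  shows "measure_pmf.prob (Pi_pmf X False (\<lambda>_. bernoulli_pmf p)) {G. P {e \<in> X. G e}} =
    rexp p X (\<lambda>W. of_bool (P W))"
proof -
  let ?M = "Pi_pmf X False (\<lambda>_. bernoulli_pmf p)"
  let ?ind = "\<lambda>W e. e \<in> W"
  have "measure_pmf.prob ?M {G. P {e \<in> X. G e}} =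
      measure_pmf.expectation ?M (indicator {G. P {e \<in> X. G e}})" by simp
  also have "\<dots> = (\<Sum>G\<in>?ind ` Pow X. indicator {G. P {e \<in> X. G e}} G * pmf ?M G)"
  proof (rule integral_measure_pmf_real)
    show "finite (?ind ` Pow X)" using assms by simp
    fix G assume "G \<in> set_pmf ?M"
    then have "G = ?ind {e \<in> X. G e}"
      using set_Pi_pmf_subset'[OF assms(1), of False "\<lambda>_. bernoulli_pmf p"] by (force simp: PiE_dflt_def)
    then show "G \<in> ?ind ` Pow X" by (rule image_eqI) auto
  qed
  also have "\<dots> = (\<Sum>W\<in>Pow X. indicator {G. P {e \<in> X. G e}} (?ind W) * pmf ?M (?ind W))"
    by (subst sum.reindex) (auto simp: inj_on_def fun_eq_iff)
  also have "\<dots> = rexp p X (\<lambda>W. of_bool (P W))"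
    unfolding rexp_def
  proof (rule sum.cong)
    fix W assume W: "W \<in> Pow X"
    then have eq: "{e \<in> X. e \<in> W} = W" by auto
    have "pmf ?M (?ind W) = (\<Prod>e\<in>X. pmf (bernoulli_pmf p) (e \<in> W))"
      using W assms by (subst pmf_Pi') auto
    also have "\<dots> = (\<Prod>e\<in>X. if e \<in> W then p else 1 - p)"
      using assms by (intro prod.cong) auto
    also have "\<dots> = p ^ card W * (1 - p) ^ card (X - W)"
      using W assms by (subst prod.If_cases) (auto simp: Int_absorb1 Diff_eq)
    finally show "indicator {G. P {e \<in> X. G e}} (?ind W) * pmf ?M (?ind W) =
        p ^ card W * (1 - p) ^ card (X - W) * of_bool (P W)"
      by (simp add: eq indicator_def)
  qed simp
  finally show ?thesis .
qed

section \<open>Spread families\<close>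

text \<open>If \<open>i \<in> A\<close>, the minimum is over a nonempty set, as \<open>j = i\<close> qualifies.\<close>

definition fragment :: "'i set \<Rightarrow> ('i \<Rightarrow> 'a set) \<Rightarrow> 'a set \<Rightarrow> 'i \<Rightarrow> 'a set" where
  "fragment A S W i =
     S (arg_min (\<lambda>j. card (S j - W)) (\<lambda>j. j \<in> A \<and> S j \<subseteq> S i \<union> W)) - W"

lemma fragment_witness:
  assumes "i \<in> A"
  obtains j where "j \<in> A" "S j \<subseteq> S i \<union> W" "fragment A S W i = S j - W"
    "\<And>l. l \<in> A \<Longrightarrow> S l \<subseteq> S i \<union> W \<Longrightarrow> card (fragment A S W i) \<le> card (S l - W)"
proof -
  let ?P = "\<lambda>j. j \<in> A \<and> S j \<subseteq> S i \<union> W" and ?c = "\<lambda>j. card (S j - W)"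
  have "?P i" using assms by auto
  from arg_min_nat_lemma[of ?P i ?c, OF this] show ?thesis
    by (intro that[of "arg_min ?c ?P"]) (auto simp: fragment_def)
qed

lemma fragment_subset: "i \<in> A \<Longrightarrow> fragment A S W i \<subseteq> S i"
  by (erule fragment_witness[of i A S W]) auto

text \<open>The key point of the encoding: whichever member \<open>S l\<close> of \<open>W \<union> T\<close> is
  chosen, where \<open>T\<close> is the fragment, minimality forces \<open>S l - W = T\<close>.\<close>

lemma fragment_eq:
  assumes "i \<in> A" "l \<in> A" "finite (S i)" "S l \<subseteq> W \<union> fragment A S W i"
  shows "fragment A S W i = S l - W"
proof -
  have sub: "S l - W \<subseteq> fragment A S W i" using assms by auto
  have fin: "finite (fragment A S W i)" by (rule finite_subset[OF fragment_subset]) fact+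
  have "S l \<subseteq> S i \<union> W" using assms fragment_subset[OF assms(1), of S W] by blast
  then have "card (fragment A S W i) \<le> card (S l - W)"
    by (metis fragment_witness[OF assms(1), of S W thesis for thesis] assms(2))
  then show ?thesis using card_seteq[OF fin sub] by simp
qed

text \<open>The normalisation \<open>M\<close> is a free parameter, so that it stays fixed when indices are discarded.\<close>

definition spread :: "'i set \<Rightarrow> ('i \<Rightarrow> 'a set) \<Rightarrow> real \<Rightarrow> real \<Rightarrow> bool" where
  "spread A S M q \<longleftrightarrow> (\<forall>I. finite I \<longrightarrow> real (card {i \<in> A. I \<subseteq> S i}) \<le> M * q ^ card I)"

text \<open>Double counting of pairs \<open>(W, i)\<close> whose fragment \<open>T\<close> is large,
  encoded by \<open>Z = W \<union> T\<close>, \<open>T\<close> and \<open>i\<close>. Given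
  \<open>Z\<close>, there are at most \<open>2 ^ r\<close> candidates for \<open>T\<close>; given
  \<open>T\<close>, spread leaves at most \<open>M * q ^ card T\<close> indices. Replacing the
  weight of \<open>Z - T\<close> by that of \<open>Z\<close> costs a factor at most
  \<open>p ^ card T\<close> in the denominator, so \<open>q / p = 1 / L\<close> remains per element
  of \<open>T\<close>.\<close>

lemma expected_large_fragments:
  fixes S :: "'i \<Rightarrow> 'a set"
  assumes X: "finite X" and A: "finite A" and SX: "\<And>i. i \<in> A \<Longrightarrow> S i \<subseteq> X"
    and cS: "\<And>i. i \<in> A \<Longrightarrow> card (S i) \<le> r"
    and sp: "spread A S M q" and q: "0 < q" and L: "1 \<le> L" "L * q \<le> 1" and M: "0 \<le> M"
  shows "rexp (L * q) X (\<lambda>W. real (card {i \<in> A. t < card (fragment A S W i)}))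
    \<le> M * 2 ^ r / L ^ Suc t"
proof -
  define p where "p = L * q"
  have p: "0 < p" "p \<le> 1" using q L by (auto simp: p_def)
  define w where "w W = p ^ card W * (1 - p) ^ card (X - W)" for W
  have w0: "0 \<le> w W" for W using p by (simp add: w_def)
  let ?F = "fragment A S"
  define B where "B = (SIGMA W:Pow X. {i \<in> A. t < card (?F W i)})"
  \<comment> \<open>The chosen member depends on \<open>Z\<close> alone, so \<open>T\<close> is
    confined to subsets of one set of size at most \<open>r\<close>.\<close>
  define c where "c Z = (SOME l. l \<in> A \<and> S l \<subseteq> Z)" for Z
  define \<Z> where "\<Z> = {Z \<in> Pow X. \<exists>l\<in>A. S l \<subseteq> Z}"
  have c: "c Z \<in> A" "S (c Z) \<subseteq> Z" if "Z \<in> \<Z>" for Z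
    using someI_ex[of "\<lambda>l. l \<in> A \<and> S l \<subseteq> Z"] that by (auto simp: c_def \<Z>_def)
  define TT where "TT Z = {T. T \<subseteq> S (c Z) \<and> t < card T}" for Z
  define D where "D = (SIGMA ZT:(SIGMA Z:\<Z>. TT Z). {i \<in> A. snd ZT \<subseteq> S i})"
  have fin\<Z>: "finite \<Z>" using X by (simp add: \<Z>_def)
  have finS: "finite (S i)" if "i \<in> A" for i using finite_subset[OF SX[OF that] X] .
  have finTT: "finite (TT Z)" if "Z \<in> \<Z>" for Z
    using finS[OF c(1)[OF that]] by (simp add: TT_def)
  have finD: "finite D" unfolding D_def using fin\<Z> finTT A by auto
  \<comment> \<open>\<open>W\<close> is recovered as \<open>Z - T\<close>, because a fragment is
    disjoint from \<open>W\<close>.\<close>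
  define enc where "enc = (\<lambda>(W, i). ((W \<union> ?F W i, ?F W i), i))"
  have disj: "W \<inter> ?F W i = {}" for W i by (auto simp: fragment_def)
  have inj: "inj_on enc B"
  proof (rule inj_onI)
    fix x y assume xy: "enc x = enc y"
    obtain W i U j where "x = (W, i)" "y = (U, j)" by (meson surj_pair)
    then show "x = y" using xy disj[of W i] disj[of U j] by (auto simp: enc_def)
  qed
  have encD: "enc b \<in> D" if bB: "b \<in> B" for b
  proof -
    obtain W i where b: "b = (W, i)" "W \<subseteq> X" "i \<in> A" "t < card (?F W i)"
      using bB by (auto simp: B_def)
    obtain j where j: "j \<in> A" "?F W i = S j - W" by (rule fragment_witness[OF b(3), of S W])
    have Z: "W \<union> ?F W i \<in> \<Z>"
      using b(2) j SX by (auto simp: \<Z>_def)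
    have "?F W i = S (c (W \<union> ?F W i)) - W"
      by (rule fragment_eq) (use b c[OF Z] finS in auto)
    then have "?F W i \<subseteq> S (c (W \<union> ?F W i))" by blast
    then show ?thesis using b Z fragment_subset[OF b(3), of S W] by (auto simp: D_def enc_def TT_def)
  qed
  have "rexp p X (\<lambda>W. real (card {i \<in> A. t < card (?F W i)})) = (\<Sum>(W, i)\<in>B. w W)"
    unfolding rexp_def B_def w_def using X A
    by (subst sum.Sigma[symmetric]) (auto simp: mult.commute)
  also have "\<dots> = (\<Sum>((Z, T), i)\<in>enc ` B. w (Z - T))"
    by (subst sum.reindex[OF inj]) (auto intro!: sum.cong simp: enc_def Un_Diff Diff_triv disj)
  also have "\<dots> \<le> (\<Sum>((Z, T), i)\<in>D. w (Z - T))"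
    using encD w0 by (intro sum_mono2 finD) auto
  also have "\<dots> = (\<Sum>Z\<in>\<Z>. \<Sum>T\<in>TT Z. w (Z - T) * card {i \<in> A. T \<subseteq> S i})"
    unfolding D_def using fin\<Z> finTT A
    by (subst sum.Sigma[symmetric], simp, simp, subst sum.Sigma, simp, simp)
      (auto intro!: sum.cong simp: mult.commute)
  also have "\<dots> \<le> (\<Sum>Z\<in>\<Z>. \<Sum>T\<in>TT Z. w Z * (M / L ^ Suc t))"
  proof (intro sum_mono)
    fix Z T assume Z: "Z \<in> \<Z>" and "T \<in> TT Z"
    then have T: "T \<subseteq> Z" "T \<subseteq> X" "t < card T" "Z \<subseteq> X" using c[OF Z] by (auto simp: TT_def \<Z>_def)
    have fT: "finite T" "finite Z" using T X finite_subset[of T X] finite_subset[of Z X] by auto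
    have cZ: "card Z = card (Z - T) + card T" using T fT by (simp add: card_Diff_subset card_mono)
    have "X - (Z - T) = (X - Z) \<union> T" using T by auto
    then have cX: "card (X - (Z - T)) = card (X - Z) + card T"
      using T fT X by (simp add: card_Un_disjoint Diff_disjoint inf_commute disjoint_iff subset_iff)
    \<comment> \<open>Moving \<open>T\<close> into the random set trades a factor
      \<open>1 - p\<close> for \<open>p\<close> per element.\<close>
    have "w (Z - T) * p ^ card T = w Z * (1 - p) ^ card T"
      by (simp add: w_def cZ cX power_add)
    also have "\<dots> \<le> w Z" using p w0 by (simp add: mult_left_le power_le_one)
    finally have 1: "w (Z - T) * p ^ card T \<le> w Z" .
    have "w (Z - T) * card {i \<in> A. T \<subseteq> S i} \<le> w (Z - T) * (M * q ^ card T)"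
      using sp fT w0 by (intro mult_left_mono) (auto simp: spread_def)
    also have "\<dots> = w (Z - T) * p ^ card T * (M / L ^ card T)"
      using L by (simp add: p_def power_mult_distrib)
    also have "\<dots> \<le> w Z * (M / L ^ card T)" using 1 M L by (intro mult_right_mono) auto
    also have "\<dots> \<le> w Z * (M / L ^ Suc t)"
      using w0 M L T by (intro mult_left_mono divide_left_mono power_increasing) auto
    finally show "w (Z - T) * card {i \<in> A. T \<subseteq> S i} \<le> w Z * (M / L ^ Suc t)" .
  qed
  also have "\<dots> \<le> (\<Sum>Z\<in>\<Z>. w Z * (M * 2 ^ r / L ^ Suc t))"
  proof (rule sum_mono)
    fix Z assume Z: "Z \<in> \<Z>"
    have "card (TT Z) \<le> card (Pow (S (c Z)))"
      using finS[OF c(1)[OF Z]] by (intro card_mono) (auto simp: TT_def)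
    also have "\<dots> \<le> 2 ^ r" using finS[OF c(1)[OF Z]] cS[OF c(1)[OF Z]] by (simp add: card_Pow)
    finally have "real (card (TT Z)) \<le> 2 ^ r" by (metis of_nat_le_iff of_nat_numeral of_nat_power)
    then have "real (card (TT Z)) * (w Z * (M / L ^ Suc t)) \<le> 2 ^ r * (w Z * (M / L ^ Suc t))"
      using w0 M L by (intro mult_right_mono) auto
    then show "(\<Sum>T\<in>TT Z. w Z * (M / L ^ Suc t)) \<le> w Z * (M * 2 ^ r / L ^ Suc t)"
      by (simp add: algebra_simps)
  qed
  also have "\<dots> \<le> (\<Sum>Z\<in>Pow X. w Z * (M * 2 ^ r / L ^ Suc t))"
    using X w0 M L by (intro sum_mono2) (auto simp: \<Z>_def)
  also have "\<dots> = rexp p X (\<lambda>_. M * 2 ^ r / L ^ Suc t)" by (simp add: rexp_def w_def)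
  also have "\<dots> = M * 2 ^ r / L ^ Suc t" using X by (rule rexp_const)
  finally show ?thesis by (simp add: p_def)
qed

section \<open>Iterating the fragment rounds\<close>

lemma spread_card_le: "spread A S M q \<Longrightarrow> real (card A) \<le> M"
  unfolding spread_def by (drule spec[of _ "{}"]) simp

lemma spread_subfamily:
  assumes "spread A S M q" "finite A" "B \<subseteq> A" "\<And>i. i \<in> B \<Longrightarrow> T i \<subseteq> S i"
  shows "spread B T M q"
  unfolding spread_def
proof (intro allI impI)
  fix I :: "'b set" assume I: "finite I"
  have "card {i \<in> B. I \<subseteq> T i} \<le> card {i \<in> A. I \<subseteq> S i}"
    using assms(2-4) by (intro card_mono) (simp, blast)
  then show "real (card {i \<in> B. I \<subseteq> T i}) \<le> M * q ^ card I"
    using assms(1) I unfolding spread_def by (meson of_nat_le_iff order_trans)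
qed

text \<open>This is the loss of one round with \<open>L = 64\<close>, sizes at most
  \<open>r = 2 ^ Suc m * s\<close> and threshold \<open>t = 2 ^ m * s\<close>. The factor
  \<open>(1/2) ^ Suc m\<close> keeps the losses of all rounds together below
  \<open>(1/4) ^ s\<close>.\<close>

lemma halving_error_bound:
  fixes s m :: nat
  assumes "1 \<le> s"
  shows "(2::real) ^ (2 ^ Suc m * s) / 64 ^ Suc (2 ^ m * s) \<le> (1/4) ^ s * (1/2) ^ Suc m"
proof -
  define a where "a = 2 ^ m * s"
  have "m + 1 \<le> 2 ^ m" by (induction m) auto
  then have "(m + 1) * s \<le> a" unfolding a_def by (intro mult_right_mono) auto
  moreover have "m \<le> m * s" using assms by simp
  moreover have "(m + 1) * s = m * s + s" by simp
  ultimately have a: "m + s \<le> a" by linarith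
  have "(2::real) ^ (2 ^ Suc m * s) / 64 ^ Suc (2 ^ m * s) = 4 ^ a / 64 ^ Suc a"
    by (simp add: a_def power_mult mult.assoc)
  also have "\<dots> \<le> (1/16) ^ a * (1/2)" by (simp add: power_divide field_simps flip: power_mult_distrib)
  also have "\<dots> \<le> (1/16) ^ (m + s) * (1/2)"
    using a by (intro mult_right_mono power_decreasing) auto
  also have "\<dots> = (1/16) ^ s * (1/16) ^ m * (1/2)" by (simp add: power_add)
  also have "\<dots> \<le> (1/4) ^ s * (1/2) ^ m * (1/2)"
    by (intro mult_right_mono mult_mono power_mono) auto
  finally show ?thesis by (simp add: mult.assoc)
qed

text \<open>Induction on the number \<open>m\<close> of rounds of density \<open>64 * q\<close>,
  each halving the size bound; a last round of density \<open>L * q\<close> finishes at size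
  \<open>s\<close>. As \<open>M\<close> is fixed, \<open>card A / M\<close> measures what survives,
  and each round subtracts the expected discarded share. The term
  \<open>(1/4) ^ s * (1 - (1/2) ^ m)\<close> is the geometric sum of these losses.\<close>

lemma spread_contains_prob:
  fixes S :: "'i \<Rightarrow> 'a set"
  assumes X: "finite X" and A: "finite A" and SX: "\<And>i. i \<in> A \<Longrightarrow> S i \<subseteq> X"
    and cS: "\<And>i. i \<in> A \<Longrightarrow> card (S i) \<le> 2 ^ m * s"
    and sp: "spread A S M q" and q: "0 < q" "64 * q \<le> 1" and L: "1 \<le> L" "L * q \<le> 1"
    and M: "0 < M" and s: "1 \<le> s"
  shows "card A / M - 2 ^ s / L - (1/4) ^ s * (1 - (1/2) ^ m)
    \<le> rexp (1 - (1 - 64 * q) ^ m * (1 - L * q)) X (\<lambda>W. of_bool (\<exists>i\<in>A. S i \<subseteq> W))"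
  using A SX cS sp
proof (induction m arbitrary: A S)
  case 0
  let ?bad = "\<lambda>W. {i \<in> A. 0 < card (fragment A S W i)}"
  have Lq: "0 \<le> L * q" using L q by simp
  have fin: "finite (fragment A S W i)" if "i \<in> A" for W i
    using fragment_subset[OF that] finite_subset[OF 0(2)[OF that] X] by (rule finite_subset)
  \<comment> \<open>A first-moment bound: if \<open>W\<close> contains no member, every fragment is
    nonempty and the left side is 0; otherwise it is at most 1, since
    \<open>card A \<le> M\<close>.\<close>
  have pointwise: "card A / M + (- 1 / M) * card (?bad W) \<le> of_bool (\<exists>i\<in>A. S i \<subseteq> W)" for W
  proof (cases "\<exists>i\<in>A. S i \<subseteq> W")
    case True
    have "card A / M \<le> 1" using spread_card_le[OF 0(4)] M by simp
    moreover have "0 \<le> card (?bad W) / M" using M by simp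
    ultimately show ?thesis using True by simp
  next
    case False
    have "?bad W = A"
    proof -
      have "0 < card (fragment A S W i)" if i: "i \<in> A" for i
      proof -
        obtain j where "j \<in> A" "fragment A S W i = S j - W" by (rule fragment_witness[OF i, of S W])
        then have "fragment A S W i \<noteq> {}" using False by auto
        then show ?thesis using fin[OF i] by (simp add: card_gt_0_iff)
      qed
      then show ?thesis by auto
    qed
    then show ?thesis using False by simp
  qed
  have "rexp (L * q) X (\<lambda>W. real (card (?bad W))) \<le> M * 2 ^ s / L ^ Suc 0"
    using X 0 q L M by (intro expected_large_fragments) auto
  then have "rexp (L * q) X (\<lambda>W. real (card (?bad W))) / M \<le> (M * 2 ^ s / L) / M"
    using M by (intro divide_right_mono) auto
  then have "card A / M - 2 ^ s / L \<le> card A / M + (- 1 / M) * rexp (L * q) X (\<lambda>W. real (card (?bad W)))"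
    using M by simp
  also have "\<dots> = rexp (L * q) X (\<lambda>W. card A / M + (- 1 / M) * card (?bad W))"
    unfolding rexp_add rexp_cmult using X by (simp add: rexp_const)
  also have "\<dots> \<le> rexp (L * q) X (\<lambda>W. of_bool (\<exists>i\<in>A. S i \<subseteq> W))"
    using Lq L pointwise by (intro rexp_mono) auto
  finally show ?case by simp
next
  case (Suc m)
  let ?p' = "1 - (1 - 64 * q) ^ m * (1 - L * q)"
  let ?err = "2 ^ s / L + (1/4) ^ s * (1 - (1/2) ^ m)"
  let ?g = "\<lambda>W. of_bool (\<exists>i\<in>A. S i \<subseteq> W) :: real"
  let ?bad = "\<lambda>U. {i \<in> A. 2 ^ m * s < card (fragment A S U i)}"
  have p': "0 \<le> ?p'" "?p' \<le> 1"
    using q L by (auto intro!: mult_le_one power_le_one)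
  \<comment> \<open>Fix the first exposed set \<open>U\<close> and apply the induction hypothesis to
    the small fragments, which inherit the spread with the same \<open>M\<close>.\<close>
  have pointwise: "(card A / M - ?err) + (- 1 / M) * card (?bad U) \<le> rexp ?p' X (\<lambda>W. ?g (U \<union> W))" for U
  proof -
    define B where "B = {i \<in> A. card (fragment A S U i) \<le> 2 ^ m * s}"
    have "A = B \<union> ?bad U" "B \<inter> ?bad U = {}" by (auto simp: B_def)
    then have "card A = card B + card (?bad U)"
      using \<open>finite A\<close> by (metis (no_types, lifting) card_Un_disjoint finite_Un)
    then have "(card A / M - ?err) + (- 1 / M) * card (?bad U) = card B / M - ?err"
      by (simp add: add_divide_distrib)
    also have "\<dots> \<le> rexp ?p' X (\<lambda>W. of_bool (\<exists>i\<in>B. fragment A S U i \<subseteq> W))"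
    proof -
      have "spread B (fragment A S U) M q"
        using Suc.prems(4,1) by (rule spread_subfamily) (auto simp: B_def fragment_subset)
      moreover have "fragment A S U i \<subseteq> X" if "i \<in> B" for i
        using that fragment_subset[of i A S U] Suc.prems(2)[of i] by (auto simp: B_def)
      moreover have "finite B" using Suc.prems(1) by (simp add: B_def)
      moreover have "card (fragment A S U i) \<le> 2 ^ m * s" if "i \<in> B" for i
        using that by (simp add: B_def)
      ultimately show ?thesis
        unfolding diff_diff_eq[symmetric] by (intro Suc.IH)
    qed
    also have "\<dots> \<le> rexp ?p' X (\<lambda>W. ?g (U \<union> W))"
    proof (intro rexp_mono p')
      fix W
      \<comment> \<open>A covered fragment \<open>S j - U\<close> completes the member
        \<open>S j\<close>, where \<open>j\<close> may differ from \<open>i\<close>.\<close>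
      have "\<exists>j\<in>A. S j \<subseteq> U \<union> W" if i: "i \<in> B" "fragment A S U i \<subseteq> W" for i
      proof -
        have "i \<in> A" using i by (simp add: B_def)
        then obtain j where "j \<in> A" "fragment A S U i = S j - U" by (rule fragment_witness[of i A S U])
        then show ?thesis using i by blast
      qed
      then show "of_bool (\<exists>i\<in>B. fragment A S U i \<subseteq> W) \<le> ?g (U \<union> W)" by (auto simp: of_bool_def)
    qed
    finally show ?thesis .
  qed
  have "rexp (64 * q) X (\<lambda>U. real (card (?bad U))) \<le> M * 2 ^ (2 ^ Suc m * s) / 64 ^ Suc (2 ^ m * s)"
    using X Suc.prems q M by (intro expected_large_fragments) auto
  also have "\<dots> \<le> M * ((1/4) ^ s * (1/2) ^ Suc m)"
    using halving_error_bound[OF s, of m] M by (subst times_divide_eq_right[symmetric]) (intro mult_left_mono, auto)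
  finally have bad: "(1 / M) * rexp (64 * q) X (\<lambda>U. real (card (?bad U))) \<le> (1/4) ^ s * (1/2) ^ Suc m"
    using M by (simp add: field_simps)
  have "card A / M - 2 ^ s / L - (1/4) ^ s * (1 - (1/2) ^ Suc m) =
      (card A / M - ?err) - (1/4) ^ s * (1/2) ^ Suc m"
    by (simp add: algebra_simps)
  also have "\<dots> \<le> (card A / M - ?err) + (- 1 / M) * rexp (64 * q) X (\<lambda>U. real (card (?bad U)))"
    using bad by simp
  also have "\<dots> = rexp (64 * q) X (\<lambda>U. (card A / M - ?err) + (- 1 / M) * card (?bad U))"
    unfolding rexp_add rexp_cmult using X by (simp add: rexp_const)
  also have "\<dots> \<le> rexp (64 * q) X (\<lambda>U. rexp ?p' X (\<lambda>W. ?g (U \<union> W)))"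
    using q pointwise by (intro rexp_mono) auto
  also have "\<dots> = rexp (1 - (1 - 64 * q) * (1 - ?p')) X ?g"
    by (rule rexp_union) fact
  finally show ?case by (simp add: mult.assoc)
qed

section \<open>Counting maps along a forest\<close>

text \<open>The left side over \<open>fact u\<close> is a single term of the exponential series at
  \<open>u\<close>.\<close>

lemma power_le_exp_fact: "real u ^ u \<le> exp (real u) * fact u"
proof -
  have s: "(\<lambda>n. real u ^ n /\<^sub>R fact n) sums exp (real u)" by (rule exp_converges)
  have "(\<Sum>n\<in>{u}. real u ^ n /\<^sub>R fact n) \<le> suminf (\<lambda>n. real u ^ n /\<^sub>R fact n)"
    using s by (intro sum_le_suminf) (auto simp: sums_iff)
  then have "real u ^ u / fact u \<le> exp (real u)"
    using s by (simp add: sums_iff divide_inverse mult.commute)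
  then show ?thesis by (simp add: field_simps)
qed

lemma power_fact_diff_le:
  assumes "u \<le> n"
  shows "real n ^ u * fact (n - u) \<le> exp (real u) * fact n"
proof (cases "u = 0")
  case False
  have "real n ^ u * fact (n - u) = (real n / real u) ^ u * real u ^ u * fact (n - u)"
    using False by (simp add: power_divide)
  also have "\<dots> \<le> real (n choose u) * (exp (real u) * fact u) * fact (n - u)"
    using binomial_ge_n_over_k_pow_k[OF assms, where 'a = real] power_le_exp_fact[of u]
    by (intro mult_right_mono mult_mono) auto
  also have "\<dots> = exp (real u) * (fact u * fact (n - u) * real (n choose u))"
    by simp
  also have "fact u * fact (n - u) * real (n choose u) = fact n"
    using binomial_fact_lemma[OF assms] by (metis of_nat_fact of_nat_mult)
  finally show ?thesis .
qed simp

text \<open>Assign the values in order of increasing rank: each vertex of \<open>J\<close> has at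
  most \<open>d\<close> choices once the value of its parent is known.\<close>

lemma card_constrained_maps_le:
  fixes rk :: "'a \<Rightarrow> nat"
  assumes "finite U" "J \<subseteq> U" "finite V"
    and "\<And>x. x \<in> J \<Longrightarrow> par x \<in> U \<and> rk (par x) < rk x"
    and d: "\<And>v. card {w \<in> V. R v w} \<le> d"
  shows "card {g \<in> U \<rightarrow>\<^sub>E V. \<forall>x\<in>J. R (g (par x)) (g x)} \<le> d ^ card J * card V ^ card (U - J)"
  using assms(1,2,4)
proof (induction "card U" arbitrary: U J)
  case 0
  then have "U = {}" "J = {}" by auto
  then show ?case by simp
next
  case (Suc u)
  let ?Maps = "\<lambda>U J. {g \<in> U \<rightarrow>\<^sub>E V. \<forall>x\<in>J. R (g (par x)) (g x)}"
  have fm: "finite (?Maps U J)" if "finite U" for U J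
    by (rule finite_subset[of _ "U \<rightarrow>\<^sub>E V"]) (use that \<open>finite V\<close> in \<open>auto intro: finite_PiE\<close>)
  have "U \<noteq> {}" using Suc.hyps(2) by auto
  \<comment> \<open>A vertex of maximal rank is nobody's parent, so deleting it leaves an instance
    of the same kind.\<close>
  then have "Max (rk ` U) \<in> rk ` U" using Suc.prems(1) by (intro Max_in) auto
  then obtain a where "a \<in> U" "Max (rk ` U) = rk a" by auto
  then have a: "a \<in> U" "\<And>x. x \<in> U \<Longrightarrow> rk x \<le> rk a"
    using Suc.prems(1) Max_ge[of "rk ` U"] by auto
  define U' J' where "U' = U - {a}" and "J' = J - {a}"
  have U: "U = insert a U'" "a \<notin> U'" "finite U'" using a Suc.prems(1) by (auto simp: U'_def)
  have par_ne: "par x \<noteq> a" if "x \<in> J" for x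
  proof
    assume "par x = a"
    then have "rk a < rk x" using Suc.prems(3)[OF that] by simp
    moreover have "rk x \<le> rk a" using that Suc.prems(2) a(2) by blast
    ultimately show False by simp
  qed
  have IH: "card (?Maps U' J') \<le> d ^ card J' * card V ^ card (U' - J')"
  proof (rule Suc.hyps(1))
    show "u = card U'" using Suc.hyps(2) U by simp
    show "par x \<in> U' \<and> rk (par x) < rk x" if "x \<in> J'" for x
      using Suc.prems(3)[of x] par_ne[of x] that by (auto simp: U'_def J'_def)
  qed (use U Suc.prems in \<open>auto simp: J'_def\<close>)
  define N where "N g = (if a \<in> J then {w \<in> V. R (g (par a)) w} else V)" for g
  define b where "b = (if a \<in> J then d else card V)"
  have N: "card (N g) \<le> b" for g using d by (simp add: N_def b_def)
  have fN: "finite (N g)" for g using \<open>finite V\<close> by (simp add: N_def)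
  have "card (?Maps U J) \<le> card (SIGMA g:?Maps U' J'. N g)"
  proof (rule card_inj_on_le)
    let ?\<phi> = "\<lambda>g. (restrict g U', g a)"
    show "inj_on ?\<phi> (?Maps U J)"
    proof (rule inj_onI)
      fix g h assume g: "g \<in> ?Maps U J" and h: "h \<in> ?Maps U J" and eq: "?\<phi> g = ?\<phi> h"
      have "g x = h x" if "x \<in> U" for x
        using that eq U(1) by (metis (no_types, lifting) fst_conv insertE restrict_apply' snd_conv)
      then show "g = h" using g h by (intro PiE_ext[of g U "\<lambda>_. V" h]) auto
    qed
    show "?\<phi> ` ?Maps U J \<subseteq> (SIGMA g:?Maps U' J'. N g)"
    proof (rule image_subsetI)
      fix g assume g: "g \<in> ?Maps U J"
      have pU: "par x \<in> U'" if "x \<in> J" for x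
        using Suc.prems(3)[OF that] par_ne[OF that] by (simp add: U'_def)
      have "restrict g U' \<in> ?Maps U' J'"
      proof -
        have "J' \<subseteq> U'" "J' \<subseteq> J" "U' \<subseteq> U" using Suc.prems(2) by (auto simp: J'_def U'_def)
        then show ?thesis using g pU by (auto simp: subset_iff)
      qed
      moreover have "g a \<in> N (restrict g U')"
        using g pU a(1) by (auto simp: N_def)
      ultimately show "?\<phi> g \<in> (SIGMA g:?Maps U' J'. N g)" by simp
    qed
    show "finite (SIGMA g:?Maps U' J'. N g)" using fm[OF U(3)] fN by blast
  qed
  also have "\<dots> = (\<Sum>g\<in>?Maps U' J'. card (N g))" using fm[OF U(3)] fN by simp
  also have "\<dots> \<le> card (?Maps U' J') * b" using sum_bounded_above[of _ "\<lambda>g. card (N g)" b] N by simp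
  also have "\<dots> \<le> d ^ card J' * card V ^ card (U' - J') * b" using IH by simp
  also have "\<dots> = d ^ card J * card V ^ card (U - J)"
  proof (cases "a \<in> J")
    case True
    then have "card J = Suc (card J')" "U' - J' = U - J"
      using card.remove[of J a] finite_subset[OF Suc.prems(2,1)] by (auto simp: J'_def U'_def)
    then show ?thesis using True by (simp add: b_def)
  next
    case False
    then have "J' = J" "U - J = insert a (U' - J)" using a(1) by (auto simp: J'_def U'_def)
    then show ?thesis using False U by (simp add: b_def)
  qed
  finally show ?case .
qed

text \<open>A bijection on \<open>Y\<close> is determined by its restriction to \<open>U\<close>, which is a constrained
  map, and an injection of \<open>Y - U\<close> into the unused values.\<close>

lemma card_constrained_bijections_le:
  fixes rk :: "'a \<Rightarrow> nat"
  assumes Y: "finite Y" "card Y = n" and V: "finite V" "card V = n" and UJ: "U \<subseteq> Y" "J \<subseteq> U"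
    and par: "\<And>x. x \<in> J \<Longrightarrow> par x \<in> U \<and> rk (par x) < rk x"
    and d: "\<And>v. card {w \<in> V. R v w} \<le> d"
  shows "card {g \<in> Y \<rightarrow>\<^sub>E V. inj_on g Y \<and> (\<forall>x\<in>J. R (g (par x)) (g x))}
    \<le> d ^ card J * n ^ card (U - J) * fact (n - card U)"
proof -
  let ?B = "{g \<in> Y \<rightarrow>\<^sub>E V. inj_on g Y \<and> (\<forall>x\<in>J. R (g (par x)) (g x))}"
  let ?M = "{g \<in> U \<rightarrow>\<^sub>E V. \<forall>x\<in>J. R (g (par x)) (g x)}"
  let ?M' = "{g \<in> ?M. inj_on g U}"
  have fU: "finite U" using finite_subset[OF UJ(1) Y(1)] .
  define N where "N g = {h \<in> (Y - U) \<rightarrow>\<^sub>E (V - g ` U). inj_on h (Y - U)}" for g :: "'a \<Rightarrow> 'b"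
  have fM: "finite ?M"
    by (rule finite_subset[of _ "U \<rightarrow>\<^sub>E V"]) (use fU V in \<open>auto intro: finite_PiE\<close>)
  have fM': "finite ?M'" using fM by (rule rev_finite_subset) blast
  have fN: "finite (N g)" for g
    unfolding N_def
    by (rule finite_subset[of _ "(Y - U) \<rightarrow>\<^sub>E (V - g ` U)"]) (use Y V in \<open>auto intro: finite_PiE\<close>)
  have cN: "card (N g) = fact (n - card U)" if "g \<in> ?M'" for g
  proof -
    have c: "card (Y - U) = n - card U" using UJ fU Y by (simp add: card_Diff_subset)
    have "g ` U \<subseteq> V" "card (g ` U) = card U" using that by (auto simp: card_image)
    then have c': "card (V - g ` U) = n - card U" using fU V by (simp add: card_Diff_subset)
    have "card (N g) = prod ((-) (card (V - g ` U))) {0..<card (Y - U)}"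
      unfolding N_def using Y V card_inj_on_subset_funcset[of "Y - U" "V - g ` U" "Y - U"] by simp
    then show ?thesis unfolding c c' by (simp add: fact_prod_rev)
  qed
  have "card ?B \<le> card (SIGMA g:?M'. N g)"
  proof (rule card_inj_on_le)
    let ?\<phi> = "\<lambda>g. (restrict g U, restrict g (Y - U))"
    show "inj_on ?\<phi> ?B"
    proof (rule inj_onI)
      fix g h assume g: "g \<in> ?B" and h: "h \<in> ?B" and eq: "?\<phi> g = ?\<phi> h"
      have "g x = h x" if "x \<in> Y" for x
        using that eq by (metis (no_types, lifting) DiffI fst_conv restrict_apply' snd_conv)
      then show "g = h" using g h by (intro PiE_ext[of g Y "\<lambda>_. V" h]) auto
    qed
    show "?\<phi> ` ?B \<subseteq> (SIGMA g:?M'. N g)"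
    proof (rule image_subsetI)
      fix g assume g: "g \<in> ?B"
      have "restrict g U \<in> ?M'"
        using g UJ par by (auto simp: inj_on_def subset_iff)
      moreover have "restrict g (Y - U) \<in> N (restrict g U)"
      proof -
        have inj: "inj_on g Y" and gY: "g \<in> Y \<rightarrow>\<^sub>E V" using g by simp_all
        have "g x \<in> V - g ` U" if "x \<in> Y - U" for x
          using that gY inj_on_image_mem_iff[OF inj, of x U] UJ(1) by auto
        moreover have "restrict g U ` U = g ` U" by (rule image_cong) auto
        ultimately show ?thesis
          using inj_on_subset[OF inj, of "Y - U"] by (simp add: N_def inj_on_restrict_eq)
      qed
      ultimately show "?\<phi> g \<in> (SIGMA g:?M'. N g)" by simp
    qed
    show "finite (SIGMA g:?M'. N g)" using fM' fN by blast
  qed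
  also have "\<dots> = (\<Sum>g\<in>?M'. card (N g))" using card_SigmaI[OF fM'] fN by blast
  also have "\<dots> = card ?M' * fact (n - card U)" using cN by simp
  \<comment> \<open>Injectivity on \<open>U\<close> is dropped; the price is the factor
    \<open>exp (card U)\<close> of \<open>power_fact_diff_le\<close>.\<close>
  also have "card ?M' \<le> card ?M" using fM by (intro card_mono) auto
  also have "card ?M \<le> d ^ card J * n ^ card (U - J)"
    using card_constrained_maps_le[OF fU UJ(2) V(1) par d] V(2) by simp
  finally show ?thesis by simp
qed

section \<open>Labelled copies of a bounded-degree forest\<close>

definition pairs :: "nat \<Rightarrow> (nat \<times> nat) set" where
  "pairs n = {(i, j). 1 \<le> i \<and> i < j \<and> j \<le> n}"

lemma finite_pairs: "finite (pairs n)"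
  by (rule finite_subset[of _ "{1..n} \<times> {1..n}"]) (auto simp: pairs_def)

text \<open>Acyclicity is encoded by an orientation: every edge joins a vertex to its parent, of
  strictly smaller rank. At a root the value of \<open>par\<close> is arbitrary. The forest is
  spanning, as \<open>card V = n\<close>.\<close>

locale ranked_forest =
  fixes V :: "'v set" and R :: "'v \<Rightarrow> 'v \<Rightarrow> bool" and par :: "'v \<Rightarrow> 'v" and rk :: "'v \<Rightarrow> nat"
    and d n :: nat
  assumes finite_V: "finite V" and card_V: "card V = n"
    and R_V: "R v w \<Longrightarrow> v \<in> V"
    and R_sym: "R v w \<Longrightarrow> R w v"
    and R_par: "R v w \<Longrightarrow> (w = par v \<and> rk w < rk v) \<or> (v = par w \<and> rk v < rk w)"
    and degree: "card {w \<in> V. R v w} \<le> d"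
begin

text \<open>A copy is indexed by the map from labels to vertices, the inverse of the embedding.\<close>

definition labelings :: "(nat \<Rightarrow> 'v) set" where
  "labelings = {g \<in> {1..n} \<rightarrow>\<^sub>E V. inj_on g {1..n}}"

definition copy_edges :: "(nat \<Rightarrow> 'v) \<Rightarrow> (nat \<times> nat) set" where
  "copy_edges g = {(x, y) \<in> pairs n. R (g x) (g y)}"

lemma finite_labelings: "finite labelings"
  unfolding labelings_def
  by (rule finite_subset[of _ "{1..n} \<rightarrow>\<^sub>E V"]) (auto intro: finite_PiE finite_V)

lemma card_labelings: "card labelings = fact n"
  using card_inj_on_subset_funcset[of "{1..n}" V "{1..n}"] finite_V card_V
  by (simp add: labelings_def fact_prod_rev)

lemma labeling_bij:
  assumes "g \<in> labelings"
  shows "bij_betw g {1..n} V"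
proof -
  have g: "inj_on g {1..n}" "g ` {1..n} \<subseteq> V" using assms by (auto simp: labelings_def)
  moreover have "card (g ` {1..n}) = card V" using card_image[OF g(1)] card_V by simp
  ultimately show ?thesis using card_subset_eq[OF finite_V] by (auto simp: bij_betw_def)
qed

text \<open>\<open>c e\<close> is the child end of the edge \<open>e\<close>, and \<open>p\<close> is the parent map transported to labels.\<close>

lemma copy_orientation:
  assumes g: "g \<in> labelings"
  obtains c p where "inj_on c (copy_edges g)"
    "\<And>e. e \<in> copy_edges g \<Longrightarrow> c e \<in> {1..n} \<and> p (c e) \<in> {1..n} \<and> rk (g (p (c e))) < rk (g (c e)) \<and>
      (e = (c e, p (c e)) \<or> e = (p (c e), c e))"
proof -
  define h where "h = inv_into {1..n} g"
  have h: "h (g x) = x" if "x \<in> {1..n}" for x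
    using labeling_bij[OF g] that by (simp add: h_def bij_betw_def inv_into_f_f)
  define p where "p x = h (par (g x))" for x
  define c where "c = (\<lambda>(x, y). if g y = par (g x) \<and> rk (g y) < rk (g x) then x else y)"
  have main: "c e \<in> {1..n} \<and> p (c e) \<in> {1..n} \<and> rk (g (p (c e))) < rk (g (c e)) \<and>
      (e = (c e, p (c e)) \<or> e = (p (c e), c e))" if e: "e \<in> copy_edges g" for e
  proof -
    obtain x y where xy: "e = (x, y)" "x \<in> {1..n}" "y \<in> {1..n}" "R (g x) (g y)"
      using e by (auto simp: copy_edges_def pairs_def)
    show ?thesis
    proof (cases "g y = par (g x) \<and> rk (g y) < rk (g x)")
      case True
      then have "c e = x" "p x = y" using xy h by (auto simp: c_def p_def) (metis h xy(3))
      then show ?thesis using True xy(1-3) by metis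
    next
      case False
      then have "g x = par (g y)" "rk (g x) < rk (g y)" using R_par[OF xy(4)] by auto
      moreover have "c e = y" using False xy by (auto simp: c_def)
      moreover have "p y = x" using calculation h[OF xy(2)] by (simp add: p_def)
      ultimately show ?thesis using xy by simp
    qed
  qed
  have "inj_on c (copy_edges g)"
  proof (rule inj_onI)
    fix e e' assume e: "e \<in> copy_edges g" "e' \<in> copy_edges g" "c e = c e'"
    have "fst e < snd e" "fst e' < snd e'" using e by (auto simp: copy_edges_def pairs_def)
    then show "e = e'" using main[OF e(1)] main[OF e(2)] e(3) by (metis fst_conv snd_conv less_asym)
  qed
  then show ?thesis using main that by blast
qed

lemma card_copy_edges_le:
  assumes "g \<in> labelings"
  shows "card (copy_edges g) \<le> n"
proof -
  obtain c p where "inj_on c (copy_edges g)" "\<And>e. e \<in> copy_edges g \<Longrightarrow> c e \<in> {1..n} \<and> p (c e) \<in> {1..n} \<and>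
      rk (g (p (c e))) < rk (g (c e)) \<and> (e = (c e, p (c e)) \<or> e = (p (c e), c e))"
    by (rule copy_orientation[OF assms]) blast
  then have "card (copy_edges g) \<le> card {1..n}" by (intro card_inj_on_le[of c]) auto
  then show ?thesis by simp
qed

text \<open>If some copy \<open>g0\<close> contains \<open>I\<close>, its orientation turns
  \<open>I\<close> into parent constraints that every other copy containing \<open>I\<close>
  satisfies too, as \<open>R\<close> is symmetric. There are \<open>card I\<close> children
  \<open>J\<close>, and the touched set \<open>U\<close> has at most \<open>2 * card I\<close>
  labels; hence the \<open>exp 2\<close> per edge.\<close>

lemma spread_copies:
  assumes n: "0 < n"
  shows "spread labelings copy_edges (fact n) (real d * exp 2 / real n)"
  unfolding spread_def
proof (intro allI impI)
  fix I :: "(nat \<times> nat) set" assume fI: "finite I"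
  show "real (card {g \<in> labelings. I \<subseteq> copy_edges g}) \<le> fact n * (real d * exp 2 / real n) ^ card I"
  proof (cases "\<exists>g\<in>labelings. I \<subseteq> copy_edges g")
    case False
    then have "card {g \<in> labelings. I \<subseteq> copy_edges g} = 0"
      by (metis (no_types, lifting) Collect_empty_eq card.empty)
    then show ?thesis by simp
  next
    case True
    then obtain g0 where g0: "g0 \<in> labelings" "I \<subseteq> copy_edges g0" by auto
    obtain c p where c: "inj_on c (copy_edges g0)"
      and cp: "\<And>e. e \<in> copy_edges g0 \<Longrightarrow> c e \<in> {1..n} \<and> p (c e) \<in> {1..n} \<and>
        rk (g0 (p (c e))) < rk (g0 (c e)) \<and> (e = (c e, p (c e)) \<or> e = (p (c e), c e))"
      by (rule copy_orientation[OF g0(1)]) blast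
    define J where "J = c ` I"
    define U where "U = J \<union> p ` J"
    have cJ: "card J = card I" unfolding J_def using c g0(2) by (metis card_image inj_on_subset)
    have fJ: "finite J" using fI by (simp add: J_def)
    have U: "U \<subseteq> {1..n}" using cp g0(2) by (fastforce simp: U_def J_def)
    have cU: "card U \<le> 2 * card I"
      unfolding U_def using card_Un_le[of J "p ` J"] card_image_le[OF fJ, of p] cJ by linarith
    have "{g \<in> labelings. I \<subseteq> copy_edges g} \<subseteq>
        {g \<in> {1..n} \<rightarrow>\<^sub>E V. inj_on g {1..n} \<and> (\<forall>x\<in>J. R (g (p x)) (g x))}"
    proof
      fix g assume g: "g \<in> {g \<in> labelings. I \<subseteq> copy_edges g}"
      have "R (g (p (c e))) (g (c e))" if "e \<in> I" for e
      proof -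
        have "e \<in> copy_edges g" using g that by auto
        then have "R (g (fst e)) (g (snd e))" by (auto simp: copy_edges_def)
        moreover have "e = (c e, p (c e)) \<or> e = (p (c e), c e)" using cp[of e] that g0(2) by blast
        ultimately show ?thesis using R_sym by (metis fst_conv snd_conv)
      qed
      then show "g \<in> {g \<in> {1..n} \<rightarrow>\<^sub>E V. inj_on g {1..n} \<and> (\<forall>x\<in>J. R (g (p x)) (g x))}"
        using g by (auto simp: labelings_def J_def)
    qed
    then have "card {g \<in> labelings. I \<subseteq> copy_edges g} \<le>
        card {g \<in> {1..n} \<rightarrow>\<^sub>E V. inj_on g {1..n} \<and> (\<forall>x\<in>J. R (g (p x)) (g x))}"
      by (rule card_mono[rotated])
        (rule finite_subset[of _ "{1..n} \<rightarrow>\<^sub>E V"], auto intro: finite_PiE finite_V)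
    also have "\<dots> \<le> d ^ card J * n ^ card (U - J) * fact (n - card U)"
    \<comment> \<open>The rank is read off from the fixed \<open>g0\<close>, while \<open>g\<close>
      varies.\<close>
    proof (rule card_constrained_bijections_le[where rk = "\<lambda>x. rk (g0 x)"])
      show "p x \<in> U \<and> rk (g0 (p x)) < rk (g0 x)" if "x \<in> J" for x
        using that cp g0(2) by (auto simp: J_def U_def)
    qed (use finite_V card_V U degree in \<open>auto simp: U_def\<close>)
    finally have "real (card {g \<in> labelings. I \<subseteq> copy_edges g})
        \<le> real (d ^ card J * n ^ card (U - J) * fact (n - card U))"
      by (rule of_nat_mono)
    also have "\<dots> = real d ^ card I * (real n ^ card U * fact (n - card U)) / real n ^ card I"
    proof -
      have "finite U" using U finite_subset by blast
      then have "card U = card (U - J) + card I"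
        using card_Diff_subset[OF fJ, of U] card_mono[of U J] cJ by (auto simp: U_def)
      then show ?thesis using n cJ by (simp add: power_add)
    qed
    also have "\<dots> \<le> real d ^ card I * (exp (real (2 * card I)) * fact n) / real n ^ card I"
    proof -
      have "card U \<le> n" using card_mono[OF _ U] by simp
      then have "real n ^ card U * fact (n - card U) \<le> exp (real (card U)) * fact n"
        by (rule power_fact_diff_le)
      also have "\<dots> \<le> exp (real (2 * card I)) * fact n"
        using cU by (intro mult_right_mono) (simp_all only: exp_le_cancel_iff of_nat_le_iff, simp)
      finally show ?thesis by (intro divide_right_mono mult_left_mono) auto
    qed
    also have "exp (real (2 * card I)) = exp 2 ^ card I"
      by (simp add: exp_of_nat_mult[symmetric] mult.commute)
    finally show ?thesis by (simp add: power_mult_distrib power_divide mult_ac)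
  qed
qed

text \<open>With \<open>L = ln n\<close>, the \<open>m + 1\<close> halving rounds take the size
  bound from \<open>2 ^ (m + 1) * s \<ge> n\<close> to \<open>s\<close>. The total density is at
  most \<open>64 * (m + 1) * q + L * q\<close>, and \<open>m + 1 \<le> 3 * L\<close> gives
  \<open>193 = 64 * 3 + 1\<close>.\<close>

lemma prob_contains_copy:
  assumes n: "3 \<le> n" and s: "1 \<le> s" and d: "1 \<le> d"
    and p: "p = 193 * (real d * exp 2) * ln (real n) / real n" "p \<le> 1"
  shows "1 - 2 ^ s / ln (real n) - (1/4) ^ s
    \<le> rexp p (pairs n) (\<lambda>W. of_bool (\<exists>g\<in>labelings. copy_edges g \<subseteq> W))"
proof -
  let ?f = "\<lambda>W. of_bool (\<exists>g\<in>labelings. copy_edges g \<subseteq> W) :: real"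
  define q where "q = real d * exp 2 / real n"
  define L where "L = ln (real n)"
  have "exp 1 \<le> (3::real)" by (rule exp_le)
  then have "exp 1 \<le> real n" using n by linarith
  then have L: "1 \<le> L" unfolding L_def using n by (subst ln_ge_iff) auto
  have q0: "0 < q" using n d by (simp add: q_def)
  have pq: "p = 193 * (L * q)" by (simp add: p L_def q_def)
  have qLq: "q \<le> L * q" using L q0 by simp
  have Lq: "193 * (L * q) \<le> 1" using p(2) pq by simp
  then have q: "64 * q < 1" "L * q < 1" using qLq q0 by linarith+
  obtain m where m: "2 ^ m < n" "n \<le> 2 ^ (m + 1)" using ex_power_ivl2[of 2 n] n by auto
  have "(2::real) ^ m < real n" using m(1) by (metis of_nat_less_iff of_nat_numeral of_nat_power)
  then have "ln ((2::real) ^ m) \<le> L" unfolding L_def using n by (subst ln_le_cancel_iff) auto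
  then have "real m * ln 2 \<le> L" by (simp add: ln_realpow)
  moreover have "real m * (1/2) \<le> real m * ln 2"
    using ln2_ge_two_thirds by (intro mult_left_mono) auto
  ultimately have mL: "real (m + 1) \<le> 3 * L" using L by simp
  let ?p' = "1 - (1 - 64 * q) ^ (m + 1) * (1 - L * q)"
  \<comment> \<open>Bernoulli's inequality bounds the density of the union by the sum of the
    densities.\<close>
  have "1 + real (m + 1) * (- (64 * q)) \<le> (1 + - (64 * q)) ^ (m + 1)"
    using q by (intro Bernoulli_inequality) auto
  then have "(1 - 64 * (real (m + 1) * q)) * (1 - L * q) \<le> (1 - 64 * q) ^ (m + 1) * (1 - L * q)"
    using q by (intro mult_right_mono) (auto simp: algebra_simps)
  moreover have "0 \<le> (64 * (real (m + 1) * q)) * (L * q)" using q0 L by simp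
  ultimately have "?p' \<le> 64 * (real (m + 1) * q) + L * q" by (simp add: algebra_simps)
  also have "\<dots> \<le> 64 * (3 * L * q) + L * q"
    using mL q0 by (intro add_right_mono mult_left_mono mult_right_mono) auto
  also have "\<dots> = p" by (simp add: pq)
  finally have p'p: "?p' \<le> p" .
  have p': "0 \<le> ?p'" "?p' < 1"
    using q q0 L by (auto intro!: mult_le_one power_le_one)
  have "1 - 2 ^ s / L - (1/4) ^ s \<le> card labelings / fact n - 2 ^ s / L - (1/4) ^ s * (1 - (1/2) ^ (m + 1))"
    by (simp add: card_labelings algebra_simps)
  also have "\<dots> \<le> rexp ?p' (pairs n) ?f"
  proof (rule spread_contains_prob[OF finite_pairs finite_labelings])
    fix g assume g: "g \<in> labelings"
    show "copy_edges g \<subseteq> pairs n" by (auto simp: copy_edges_def)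
    have "card (copy_edges g) \<le> 2 ^ (m + 1) * 1" using card_copy_edges_le[OF g] m(2) by simp
    also have "\<dots> \<le> 2 ^ (m + 1) * s" using s by (intro mult_left_mono) auto
    finally show "card (copy_edges g) \<le> 2 ^ (m + 1) * s" .
  next
    show "spread labelings copy_edges (fact n) q" unfolding q_def using n by (intro spread_copies) simp
  qed (use q q0 L s in auto)
  also have "\<dots> \<le> rexp p (pairs n) ?f"
  proof (rule rexp_mono_density[OF finite_pairs p'(1) p'p p(2) p'(2)])
    show "?f U \<le> ?f W" if "U \<subseteq> W" for U W
      using subset_trans[OF _ that] by (auto simp: of_bool_def)
  qed
  finally show ?thesis by (simp add: L_def)
qed

end

section \<open>Combs\<close>

definition comb_adj :: "nat \<Rightarrow> nat \<Rightarrow> nat \<times> nat \<Rightarrow> nat \<times> nat \<Rightarrow> bool" where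
  "comb_adj n k a b \<longleftrightarrow> comb_edge n k a b \<or> comb_edge n k b a"

text \<open>Truncated subtraction sends the root \<open>(0, 0)\<close> to itself.\<close>

definition comb_parent :: "nat \<times> nat \<Rightarrow> nat \<times> nat" where
  "comb_parent = (\<lambda>(i, j). if j = 0 then (i - 1, 0) else (i, j - 1))"

text \<open>The rank \<open>i + j\<close> is the distance to the root \<open>(0, 0)\<close>. The
  degree bound 4 just counts grid neighbours.\<close>

lemma comb_ranked_forest:
  assumes "k dvd n"
  shows "ranked_forest (comb_verts n k) (comb_adj n k) comb_parent (\<lambda>(i, j). i + j) 4 n"
proof
  show "finite (comb_verts n k)" "card (comb_verts n k) = n"
    using assms by (simp_all add: comb_verts_def)
  fix v w
  show "card {w \<in> comb_verts n k. comb_adj n k v w} \<le> 4"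
  proof -
    obtain i j where v: "v = (i, j)" by (cases v)
    have "{w \<in> comb_verts n k. comb_adj n k v w} \<subseteq> set [(i + 1, j), (i - 1, j), (i, j + 1), (i, j - 1)]"
      by (auto simp: v comb_adj_def comb_edge_def)
    then have "card {w \<in> comb_verts n k. comb_adj n k v w}
        \<le> card (set [(i + 1, j), (i - 1, j), (i, j + 1), (i, j - 1)])"
      by (intro card_mono) auto
    also have "\<dots> \<le> 4" by (rule order_trans[OF card_length]) simp
    finally show ?thesis .
  qed
  assume vw: "comb_adj n k v w"
  show "v \<in> comb_verts n k" "comb_adj n k w v"
    using vw by (auto simp: comb_adj_def comb_edge_def)
  have *: "a = comb_parent b \<and> (case a of (i, j) \<Rightarrow> i + j) < (case b of (i, j) \<Rightarrow> i + j)"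
    if "comb_edge n k a b" for a b
    using that by (cases a, cases b) (auto simp: comb_edge_def comb_parent_def)
  then show "(w = comb_parent v \<and> (case w of (i, j) \<Rightarrow> i + j) < (case v of (i, j) \<Rightarrow> i + j)) \<or>
      (v = comb_parent w \<and> (case v of (i, j) \<Rightarrow> i + j) < (case w of (i, j) \<Rightarrow> i + j))"
    using vw unfolding comb_adj_def by blast
qed

lemma contains_combI:
  assumes "ranked_forest V (comb_adj n k) par rk d n" and V: "V = comb_verts n k"
    and g: "g \<in> ranked_forest.labelings V n"
    and G: "ranked_forest.copy_edges (comb_adj n k) n g \<subseteq> {e \<in> pairs n. G e}"
  shows "contains_comb n k G"
proof -
  interpret ranked_forest V "comb_adj n k" par rk d n by fact
  define f where "f = inv_into {1..n} g"
  have bij: "bij_betw g {1..n} V" using g by (rule labeling_bij)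
  have fb: "bij_betw f V {1..n}" unfolding f_def using bij by (rule bij_betw_inv_into)
  have gf: "g (f a) = a" if "a \<in> V" for a
    using bij_betw_inv_into_right[OF bij that] by (simp add: f_def)
  have "adj G (f a) (f b)" if ab: "comb_edge n k a b" for a b
  proof -
    have V': "a \<in> V" "b \<in> V" "a \<noteq> b" using ab by (auto simp: V comb_edge_def)
    then have ne: "f a \<noteq> f b" using gf by metis
    have r: "f a \<in> {1..n}" "f b \<in> {1..n}" using fb V' by (auto simp: bij_betw_def)
    have R: "comb_adj n k (g (f a)) (g (f b))" "comb_adj n k (g (f b)) (g (f a))"
      using ab V' by (simp_all add: gf comb_adj_def)
    have "(min (f a) (f b), max (f a) (f b)) \<in> copy_edges g"
      using ne r R by (auto simp: copy_edges_def pairs_def min_def max_def)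
    then show ?thesis using G ne by (auto simp: adj_def)
  qed
  then show ?thesis
    using fb unfolding contains_comb_def V bij_betw_def by (intro exI[of _ f]) auto
qed

text \<open>Degree bound 4 gives \<open>772 = 193 * 4\<close>. The bound is uniform in
  \<open>k\<close>, so \<open>k\<close> may vary with \<open>n\<close>.\<close>

lemma prob_gnp_contains_comb:
  assumes n: "3 \<le> n" and k: "k dvd n" and s: "1 \<le> s"
    and p: "p = 772 * exp 2 * ln (real n) / real n" "p \<le> 1"
  shows "1 - 2 ^ s / ln (real n) - (1/4) ^ s \<le> measure_pmf.prob (gnp n p) {G. contains_comb n k G}"
proof -
  interpret ranked_forest "comb_verts n k" "comb_adj n k" comb_parent "\<lambda>(i, j). i + j" 4 n
    using k by (rule comb_ranked_forest)
  let ?P = "\<lambda>W. \<exists>g\<in>labelings. copy_edges g \<subseteq> W"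
  have p0: "0 \<le> p" using n p(1) by simp
  have "1 - 2 ^ s / ln (real n) - (1/4) ^ s \<le> rexp p (pairs n) (\<lambda>W. of_bool (?P W))"
    using n s p by (intro prob_contains_copy) auto
  also have "\<dots> = measure_pmf.prob (gnp n p) {G. ?P {e \<in> pairs n. G e}}"
    unfolding gnp_def pairs_def[symmetric] using finite_pairs p0 p(2) by (rule prob_Pi_bernoulli[symmetric])
  also have "\<dots> \<le> measure_pmf.prob (gnp n p) {G. contains_comb n k G}"
    using contains_combI[OF ranked_forest_axioms refl]
    by (intro measure_pmf.finite_measure_mono) auto
  finally show ?thesis .
qed

theorem theorem1p2:
  shows "\<exists>C::real. C > 0 \<and>
    (\<forall>k :: nat \<Rightarrow> nat. (\<forall>n\<ge>1. k n \<ge> 1 \<and> k n dvd n) \<longrightarrow>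
      (\<lambda>n. measure_pmf.prob (gnp n (C * ln (real n) / real n)) {G. contains_comb n (k n) G})
        \<longlonglongrightarrow> 1)"
proof (intro exI conjI allI impI)
  define C :: real where "C = 772 * exp 2"
  show "C > 0" by (simp add: C_def)
  fix k :: "nat \<Rightarrow> nat" assume k: "\<forall>n\<ge>1. k n \<ge> 1 \<and> k n dvd n"
  let ?pr = "\<lambda>n. measure_pmf.prob (gnp n (C * ln (real n) / real n)) {G. contains_comb n (k n) G}"
  have "(\<lambda>n. C * (ln (real n) / real n)) \<longlonglongrightarrow> C * 0"
    by (intro tendsto_intros lim_ln_over_n)
  then have "\<forall>\<^sub>F n in sequentially. C * (ln (real n) / real n) < 1"
    by (rule order_tendstoD) simp
  then have small: "\<forall>\<^sub>F n in sequentially. C * ln (real n) / real n \<le> 1"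
    by eventually_elim simp
  show "?pr \<longlonglongrightarrow> 1"
  proof (rule order_tendstoI)
    fix a :: real assume "1 < a"
    then show "\<forall>\<^sub>F n in sequentially. ?pr n < a"
      by (intro always_eventually allI) (meson measure_pmf.prob_le_1 le_less_trans)
  next
    fix a :: real assume a: "a < 1"
    \<comment> \<open>First \<open>s = Suc s0\<close>, which is at least 1, is fixed to make
      \<open>(1/4) ^ s\<close> small; then \<open>n\<close> grows until \<open>2 ^ s / ln n\<close>
      is small.\<close>
    obtain s0 where "(1/4) ^ s0 < (1 - a) / 2" using real_arch_pow_inv[of "(1 - a) / 2" "1/4"] a by auto
    moreover have "(1/4 :: real) ^ Suc s0 \<le> (1/4) ^ s0" by (rule power_decreasing) auto
    ultimately have s: "(1/4) ^ Suc s0 < (1 - a) / 2" by linarith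
    have "(\<lambda>n. 2 ^ Suc s0 / ln (real n)) \<longlonglongrightarrow> 0"
      by (intro tendsto_divide_0[OF tendsto_const] filterlim_at_top_imp_at_infinity
          filterlim_compose[OF ln_at_top filterlim_real_sequentially])
    then have "\<forall>\<^sub>F n in sequentially. 2 ^ Suc s0 / ln (real n) < (1 - a) / 2"
      by (rule order_tendstoD) (use a in simp)
    with small eventually_ge_at_top[of 3] show "\<forall>\<^sub>F n in sequentially. a < ?pr n"
    proof eventually_elim
      case (elim n)
      have "1 - 2 ^ Suc s0 / ln (real n) - (1/4) ^ Suc s0 \<le> ?pr n"
        using k elim by (intro prob_gnp_contains_comb) (auto simp: C_def)
      then show ?case using s elim by argo
    qed
  qed
qed

end
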